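(* Let $K$ be an $(n-1)$-dimensional simplicial complex on $[m]=\{1,\dots,m\}$ and let $r\le 3$ be a non-negative integer. Then every rank $r$ subgroup of $\mathbb{Z}_2^m$ acting freely on the real moment-angle complex $\mathbb{R}\mathcal{Z}_K$ is induced by an $r$-dimensional subtorus of $T^m$ acting freely on the moment-angle complex $\mathcal{Z}_K$.
   Context: For a simplicial complex $K$ on $[m]$ and a pair of spaces $(X,Y)$, the polyhedral product is $(\underline{X},\underline{Y})^K=\bigcup_{\sigma\in K}\{(x_1,\dots,x_m)\in X^m \mid x_i\in Y \text{ when } i\notin\sigma\}$. With $D^d=\{\mathbf{x}\in\mathbb{R}^d : \|\mathbf{x}\|\le 1\}$ and $S^{d-1}=\partial D^d$, put $\mathcal{Z}_K=(\underline{D^2},\underline{S^1})^K$ and $\mathbb{R}\mathcal{Z}_K=(\underline{D^1},\underline{S^0})^K$. The torus $T^m=(S^1)^m$ acts on $\mathcal{Z}_K$ by coordinatewise rotation of $D^2\subset\mathbb{C}$, and $\mathbb{Z}_2^m$ (with $\mathbb{Z}_2=\mathbb{Z}/2\mathbb{Z}$ identified with $S^0=\{\pm1\}$) acts on $\mathbb{R}\mathcal{Z}_K$ by coordinatewise sign changes. An $r$-dimensional subtorus $H\subset T^m$ can be written as $H=\{(e^{2\pi i(s_{11}\phi_1+\dots+s_{1r}\phi_r)},\dots,e^{2\pi i(s_{m1}\phi_1+\dots+s_{mr}\phi_r)}) \mid \phi_1,\dots,\phi_r\in\mathbb{R}\}$, where the columns of the integer $m\times r$ matrix $S=(s_{ij})$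 form a basis of a rank $r$ direct summand of $\mathbb{Z}^m$. The subgroup of $\mathbb{Z}_2^m$ induced by $H$ is the rank $r$ subgroup spanned by the columns of the mod $2$ reduction of $S$ (equivalently, $H\cap\{\pm1\}^m$). *)

theory Defs
  imports
    "HOL-Analysis.Analysis"
    "HOL-Algebra.Product_Groups"
    "HOL-Algebra.Group_Action"
begin

text \<open>
  Points of \<open>X\<^sup>m\<close> are extensional functions in \<open>{1..m} \<rightarrow>\<^sub>E X\<close>. An \<open>m \<times> r\<close> integer matrix is a
  function \<open>S :: nat \<Rightarrow> nat \<Rightarrow> int\<close> of which only the entries \<open>S i j\<close> with \<open>i \<in> {1..m}\<close> and
  \<open>j \<in> {1..r}\<close> are used.
\<close>

text \<open>Ghost vertices, that is \<open>i \<in> {1..m}\<close> with \<open>{i} \<notin> K\<close>, are allowed.\<close>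

definition simplicial_complex_on :: "nat \<Rightarrow> nat set set \<Rightarrow> bool" where
  "simplicial_complex_on m K \<longleftrightarrow>
     K \<subseteq> Pow {1..m} \<and> {} \<in> K \<and> (\<forall>\<sigma>\<in>K. \<forall>\<tau>. \<tau> \<subseteq> \<sigma> \<longrightarrow> \<tau> \<in> K)"

definition complex_dim :: "nat set set \<Rightarrow> int" where
  "complex_dim K = Max ((\<lambda>\<sigma>. int (card \<sigma>) - 1) ` K)"

definition polyhedral_product :: "nat \<Rightarrow> nat set set \<Rightarrow> 'a set \<Rightarrow> 'a set \<Rightarrow> (nat \<Rightarrow> 'a) set" where
  "polyhedral_product m K X Y =
     (\<Union>\<sigma>\<in>K. {x \<in> {1..m} \<rightarrow>\<^sub>E X. \<forall>i\<in>{1..m}. i \<notin> \<sigma> \<longrightarrow> x i \<in> Y})"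

definition moment_angle_complex :: "nat \<Rightarrow> nat set set \<Rightarrow> (nat \<Rightarrow> complex) set" where
  "moment_angle_complex m K = polyhedral_product m K (cball 0 1) (sphere 0 1)"

definition real_moment_angle_complex :: "nat \<Rightarrow> nat set set \<Rightarrow> (nat \<Rightarrow> real) set" where
  "real_moment_angle_complex m K = polyhedral_product m K (cball 0 1) (sphere 0 1)"

definition circle_group :: "complex monoid" where
  "circle_group = \<lparr>carrier = sphere 0 1, monoid.mult = (*), one = 1\<rparr>"

definition torus_group :: "nat \<Rightarrow> (nat \<Rightarrow> complex) monoid" where
  "torus_group m = product_group {1..m} (\<lambda>_. circle_group)"

definition torus_topology :: "nat \<Rightarrow> (nat \<Rightarrow> complex) topology" where
  "torus_topology m = product_topology (\<lambda>_. top_of_set (sphere 0 1)) {1..m}"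

definition Z2_power :: "nat \<Rightarrow> (nat \<Rightarrow> int) monoid" where
  "Z2_power m = product_group {1..m} (\<lambda>_. integer_mod_group 2)"

definition Z_power :: "nat \<Rightarrow> (nat \<Rightarrow> int) monoid" where
  "Z_power m = product_group {1..m} (\<lambda>_. integer_group)"

definition torus_action :: "nat \<Rightarrow> (nat \<Rightarrow> complex) \<Rightarrow> (nat \<Rightarrow> complex) \<Rightarrow> (nat \<Rightarrow> complex)" where
  "torus_action m t x = (\<lambda>i\<in>{1..m}. t i * x i)"

text \<open>The residues \<open>0\<close> and \<open>1\<close> are identified with the signs \<open>1\<close> and \<open>-1\<close>, respectively.\<close>

definition sign_action :: "nat \<Rightarrow> (nat \<Rightarrow> int) \<Rightarrow> (nat \<Rightarrow> real) \<Rightarrow> (nat \<Rightarrow> real)" where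
  "sign_action m g x = (\<lambda>i\<in>{1..m}. (- 1) ^ nat (g i) * x i)"

definition acts_freely :: "('a, 'c) monoid_scheme \<Rightarrow> ('a \<Rightarrow> 'b \<Rightarrow> 'b) \<Rightarrow> 'b set \<Rightarrow> bool" where
  "acts_freely G \<phi> E \<longleftrightarrow> (\<forall>x\<in>E. stabilizer G \<phi> x = {\<one>\<^bsub>G\<^esub>})"

definition Z2_subgroup_of_rank :: "nat \<Rightarrow> nat \<Rightarrow> (nat \<Rightarrow> int) set \<Rightarrow> bool" where
  "Z2_subgroup_of_rank m r G \<longleftrightarrow>
     subgroup G (Z2_power m) \<and> (Z2_power m)\<lparr>carrier := G\<rparr> \<cong> Z2_power r"

text \<open>A subtorus of dimension \<open>r\<close> is a subgroup of \<open>T\<^sup>m\<close> isomorphic to \<open>T\<^sup>r\<close> as a topological group.\<close>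

definition subtorus :: "nat \<Rightarrow> nat \<Rightarrow> (nat \<Rightarrow> complex) set \<Rightarrow> bool" where
  "subtorus m r H \<longleftrightarrow>
     subgroup H (torus_group m) \<and>
     (\<exists>f. f \<in> iso (torus_group r) ((torus_group m)\<lparr>carrier := H\<rparr>) \<and>
          homeomorphic_map (torus_topology r) (subtopology (torus_topology m) H) f)"

text \<open>For an abelian group \<open>G\<close>.\<close>

definition direct_summand :: "('a, 'c) monoid_scheme \<Rightarrow> 'a set \<Rightarrow> bool" where
  "direct_summand G L \<longleftrightarrow>
     subgroup L G \<and>
     (\<exists>M. subgroup M G \<and> L \<inter> M = {\<one>\<^bsub>G\<^esub>} \<and> L <#>\<^bsub>G\<^esub> M = carrier G)"

text \<open>The bijection says that every element of \<open>L\<close> is a unique integral combination of the columns.\<close>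

definition columns_basis_of :: "nat \<Rightarrow> nat \<Rightarrow> (nat \<Rightarrow> nat \<Rightarrow> int) \<Rightarrow> (nat \<Rightarrow> int) set \<Rightarrow> bool" where
  "columns_basis_of m r S L \<longleftrightarrow>
     bij_betw (\<lambda>c. \<lambda>i\<in>{1..m}. \<Sum>j=1..r. c j * S i j) ({1..r} \<rightarrow>\<^sub>E UNIV) L"

definition matrix_torus :: "nat \<Rightarrow> nat \<Rightarrow> (nat \<Rightarrow> nat \<Rightarrow> int) \<Rightarrow> (nat \<Rightarrow> complex) set" where
  "matrix_torus m r S =
     {\<lambda>i\<in>{1..m}. exp (2 * of_real pi * \<i> * of_real (\<Sum>j=1..r. of_int (S i j) * \<phi> j))
      | \<phi> :: nat \<Rightarrow> real. True}"

definition mod2_column_span :: "nat \<Rightarrow> nat \<Rightarrow> (nat \<Rightarrow> nat \<Rightarrow> int) \<Rightarrow> (nat \<Rightarrow> int) set" where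
  "mod2_column_span m r S = generate (Z2_power m) ((\<lambda>j. \<lambda>i\<in>{1..m}. S i j mod 2) ` {1..r})"

text \<open>
  \<open>G\<close> is the subgroup of \<open>\<int>\<^sub>2\<^sup>m\<close> induced by the \<open>r\<close>-dimensional subtorus \<open>H\<close>. It does not depend on
  the choice of \<open>S\<close>: under the identification of residues with signs it is the intersection of
  \<open>H\<close> with \<open>{1, -1}\<^sup>m\<close>.
\<close>

definition induced_by_subtorus ::
    "nat \<Rightarrow> nat \<Rightarrow> (nat \<Rightarrow> int) set \<Rightarrow> (nat \<Rightarrow> complex) set \<Rightarrow> bool" where
  "induced_by_subtorus m r G H \<longleftrightarrow>
     (\<exists>S L. direct_summand (Z_power m) L \<and> columns_basis_of m r S L \<and>
            H = matrix_torus m r S \<and> G = mod2_column_span m r S)"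

end

theory Submission
  imports Defs
begin

text \<open>
  Let the columns of \<open>S\<close> be a basis of \<open>G\<close>, lifted from residues to the integers \<open>0\<close> and \<open>1\<close>. Freeness of
  \<open>G\<close> says that for every simplex \<open>\<sigma>\<close> the rows of \<open>S\<close> outside \<open>\<sigma>\<close> span \<open>\<int>\<^sub>2\<^sup>r\<close>, hence contain an
  \<open>r \<times> r\<close> minor of odd determinant. A \<open>0/1\<close> determinant of size at most \<open>3\<close> has absolute value at
  most \<open>2\<close>, so this minor is \<open>1\<close> or \<open>-1\<close>, and the rows outside \<open>\<sigma>\<close> span \<open>\<int>\<^sup>r\<close>. That is freeness of the
  torus of \<open>S\<close>, and for the empty simplex it makes the columns a basis of a direct summand.
\<close>

section \<open>Integral spanning by rows of 0/1 matrices with at most three columns\<close>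

text \<open>The rows of \<open>S\<close> indexed by \<open>I\<close> generate the lattice of integer
  row vectors of length \<open>r\<close>. In this form the coefficients \<open>a\<close> for the
  various \<open>k\<close> are the rows of an integral left inverse.\<close>

definition rows_span :: "nat set \<Rightarrow> nat \<Rightarrow> (nat \<Rightarrow> nat \<Rightarrow> int) \<Rightarrow> bool" where
  "rows_span I r S \<longleftrightarrow>
     (\<forall>k\<in>{1..r}. \<exists>a. \<forall>j\<in>{1..r}. (\<Sum>i\<in>I. a i * S i j) = of_bool (j = k))"

text \<open>The indicator weights are added, so the three indices may coincide.\<close>

lemma sum_three_point_combination:
  fixes x :: "'a \<Rightarrow> int"
  assumes "finite I" "i1 \<in> I" "i2 \<in> I" "i3 \<in> I"
  shows "(\<Sum>i\<in>I. (of_bool (i = i1) * p + of_bool (i = i2) * q + of_bool (i = i3) * s) * x i)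
         = p * x i1 + q * x i2 + s * x i3"
proof -
  have "(\<Sum>i\<in>I. of_bool (i = i0) * c * x i) = c * x i0" if "i0 \<in> I" for i0 c
  proof -
    have "(\<Sum>i\<in>I. of_bool (i = i0) * c * x i) = (\<Sum>i\<in>I. if i = i0 then c * x i else 0)"
      by (rule sum.cong) auto
    then show ?thesis using assms that by simp
  qed
  then show ?thesis using assms by (simp add: distrib_right sum.distrib)
qed

text \<open>Cramer's rule yields \<open>d\<close> times each unit vector, with \<open>d\<close> a
  minor. As \<open>d * d = 1\<close>, multiplying by \<open>d\<close> once more removes the factor.
  Three slots serve every size up to 3: smaller sizes repeat a row.\<close>

lemma rows_spanI_three_rows:
  assumes "finite I" and "d * d = 1"
    and "\<And>k. k \<in> {1..r} \<Longrightarrow> \<exists>i1\<in>I. \<exists>i2\<in>I. \<exists>i3\<in>I. \<exists>p q s. \<forall>j\<in>{1..r}.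
           p * S i1 j + q * S i2 j + s * S i3 j = d * of_bool (j = k)"
  shows "rows_span I r S"
  unfolding rows_span_def
proof
  fix k assume "k \<in> {1..r}"
  from assms(3)[OF this] obtain i1 i2 i3 p q s where
    i: "i1 \<in> I" "i2 \<in> I" "i3 \<in> I" and
    e: "\<And>j. j \<in> {1..r} \<Longrightarrow> p * S i1 j + q * S i2 j + s * S i3 j = d * of_bool (j = k)"
    by blast
  have "d * p * S i1 j + d * q * S i2 j + d * s * S i3 j = of_bool (j = k)" if "j \<in> {1..r}" for j
  proof -
    have "d * p * S i1 j + d * q * S i2 j + d * s * S i3 j = d * (p * S i1 j + q * S i2 j + s * S i3 j)"
      by (simp add: distrib_left mult.assoc)
    also have "\<dots> = d * d * of_bool (j = k)"
      by (simp only: e[OF that] mult.assoc)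
    finally show ?thesis using assms(2) by simp
  qed
  then show "\<exists>a. \<forall>j\<in>{1..r}. (\<Sum>i\<in>I. a i * S i j) = of_bool (j = k)"
    by (intro ballI exI[where x = "\<lambda>i. of_bool (i = i1) * (d * p) + of_bool (i = i2) * (d * q)
          + of_bool (i = i3) * (d * s)"])
      (simp only: sum_three_point_combination[OF assms(1) i])
qed

text \<open>Here \<open>d\<close> is the determinant with rows u, v, w. The bound 2 on its absolute
  value comes from checking all 512 matrices. In size 4 the determinant 3 occurs, so this argument
  stops at 3.\<close>

lemma odd_det3_zero_one:
  fixes u1 u2 u3 v1 v2 v3 w1 w2 w3 d :: int
  assumes 01: "{u1, u2, u3, v1, v2, v3, w1, w2, w3} \<subseteq> {0, 1}"
    and d: "d = w1 * (u2 * v3 - u3 * v2) + w2 * (u3 * v1 - u1 * v3) + w3 * (u1 * v2 - u2 * v1)"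
    and "odd d"
  shows "d * d = 1"
proof -
  have w: "w1 \<in> {0, 1}" "w2 \<in> {0, 1}" "w3 \<in> {0, 1}"
    and uv: "u1 \<in> {0, 1}" "u2 \<in> {0, 1}" "u3 \<in> {0, 1}" "v1 \<in> {0, 1}" "v2 \<in> {0, 1}" "v3 \<in> {0, 1}"
    using 01 by blast+
  have "- 3 < d \<and> d < 3"
    using uv w unfolding d by (elim insertE emptyE) simp_all
  with \<open>odd d\<close> have "d = 1 \<or> d = -1" by presburger
  then show ?thesis by auto
qed

text \<open>A set \<open>A\<close> is the support of a linear functional mod 2, so
  \<open>odd\<close> says that no nonzero functional kills all rows. Rows are found one at a time:
  each new row is one on which a functional that is even on the earlier rows takes an odd
  value.\<close>

lemma rows_span_zero_one:
  assumes "finite I" and "r \<le> 3"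
    and S01: "\<And>i j. i \<in> I \<Longrightarrow> j \<in> {1..r} \<Longrightarrow> S i j \<in> {0, 1}"
    and odd: "\<And>A. A \<subseteq> {1..r} \<Longrightarrow> A \<noteq> {} \<Longrightarrow> \<exists>i\<in>I. odd (\<Sum>j\<in>A. S i j)"
  shows "rows_span I r S"
proof -
  have two_rows: "\<exists>i\<in>I. \<exists>k\<in>I. S i 1 = 1 \<and> odd (S i 2 * S k 1 + S k 2)" if r: "{1, 2} \<subseteq> {1..r}"
  proof -
    from odd[of "{1}"] r obtain i where i: "i \<in> I" "odd (S i 1)" by auto
    with S01[of i 1] r have i1: "S i 1 = 1" by auto
    \<comment> \<open>The functional with coefficients \<open>S i 2\<close> and \<open>1\<close>
      takes the even value \<open>2 * S i 2\<close> on row \<open>i\<close>, since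
      \<open>S i 1 = 1\<close>. Its support is \<open>{2}\<close> or \<open>{1, 2}\<close>.\<close>
    have "\<exists>k\<in>I. odd (S i 2 * S k 1 + S k 2)"
    proof (cases "S i 2 = 0")
      case True
      then show ?thesis using odd[of "{2}"] r by auto
    next
      case False
      then show ?thesis using odd[of "{1, 2}"] S01[of i 2] i r by auto
    qed
    with i i1 show ?thesis by blast
  qed
  consider "r = 0" | "r = 1" | "r = 2" | "r = 3" using assms(2) by linarith
  then show ?thesis
  proof cases
    case 1
    then show ?thesis by (simp add: rows_span_def)
  next
    case 2
    from odd[of "{1}"] 2 obtain i where i: "i \<in> I" "odd (S i 1)" by auto
    with S01[of i 1] 2 have "S i 1 = 1" by auto
    then have "\<forall>j\<in>{1..r}. 1 * S i j + 0 * S i j + 0 * S i j = 1 * of_bool (j = k)"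
      if "k \<in> {1..r}" for k
      using 2 that by auto
    then show ?thesis
      by (intro rows_spanI_three_rows[where d = 1, OF assms(1)])
        (simp, intro bexI[OF bexI[OF bexI[OF _ i(1)] i(1)] i(1)] exI)
  next
    case 3
    have r: "{1..r} = {1, 2}" using 3 by auto
    obtain i k where i: "i \<in> I" "S i 1 = 1" and k: "k \<in> I" "odd (S i 2 * S k 1 + S k 2)"
      using two_rows r by blast
    \<comment> \<open>The 2 x 2 minor of rows \<open>i\<close> and \<open>k\<close>, simplified by
      \<open>S i 1 = 1\<close>; below, its adjugate supplies the coefficients.\<close>
    define d where "d = S k 2 - S i 2 * S k 1"
    have "S k 1 \<in> {0, 1}" "S k 2 \<in> {0, 1}" "S i 2 \<in> {0, 1}"
      using S01 i(1) k(1) r by blast+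
    then have "d \<in> {-1, 0, 1}"
      unfolding d_def by (elim insertE emptyE) simp_all
    moreover have "odd d" using k(2) by (simp add: d_def)
    ultimately have dd: "d * d = 1" by auto
    have "\<forall>j\<in>{1, 2}. S k 2 * S i j + (- S i 2) * S k j + 0 * S k j = d * of_bool (j = 1)"
      using i(2) by (simp add: d_def)
    moreover have "\<forall>j\<in>{1, 2}. (- S k 1) * S i j + 1 * S k j + 0 * S k j = d * of_bool (j = 2)"
      using i(2) by (simp add: d_def)
    ultimately have "\<forall>h\<in>{1, 2}. \<exists>p q s. \<forall>j\<in>{1, 2}.
        p * S i j + q * S k j + s * S k j = d * of_bool (j = h)"
      by (intro ballI, elim insertE emptyE) (hypsubst, intro exI, assumption)+
    then show ?thesis
      by (intro rows_spanI_three_rows[OF assms(1) dd], unfold r)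
        (rule bexI[OF bexI[OF bexI[OF _ k(1)] k(1)] i(1)], rule bspec)
  next
    case 4
    have r: "{1..r} = {1, 2, 3}" using 4 by auto
    obtain i k where i: "i \<in> I" "S i 1 = 1" and k: "k \<in> I" "odd (S i 2 * S k 1 + S k 2)"
      using two_rows r by blast
    \<comment> \<open>The vector c is the cross product of rows \<open>i\<close> and
      \<open>k\<close>, hence a functional vanishing on both.\<close>
    define c1 where "c1 = S i 2 * S k 3 - S i 3 * S k 2"
    define c2 where "c2 = S i 3 * S k 1 - S i 1 * S k 3"
    define c3 where "c3 = S i 1 * S k 2 - S i 2 * S k 1"
    have c3: "odd c3" using k(2) i(2) by (simp add: c3_def)
    \<comment> \<open>The support of c mod 2; it contains 3 because \<open>c3\<close> is
      odd.\<close>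
    define A :: "nat set" where "A = {3} \<union> (if odd c1 then {1} else {}) \<union> (if odd c2 then {2} else {})"
    have "A \<subseteq> {1..r}" "A \<noteq> {}" using r by (auto simp: A_def)
    from odd[OF this] obtain l where l: "l \<in> I" "odd (\<Sum>j\<in>A. S l j)" by blast
    \<comment> \<open>The determinant of rows \<open>i\<close>, \<open>k\<close>, \<open>l\<close>,
      expanded along row \<open>l\<close>. Mod 2 it is the sum of row \<open>l\<close> over
      \<open>A\<close>.\<close>
    define d where "d = S l 1 * c1 + S l 2 * c2 + S l 3 * c3"
    have "odd d" using l(2) c3 by (auto simp: d_def A_def split: if_splits)
    have "{S i 1, S i 2, S i 3, S k 1, S k 2, S k 3, S l 1, S l 2, S l 3} \<subseteq> {0, 1}"
      using S01 i(1) k(1) l(1) r by blast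
    then have dd: "d * d = 1"
      by (rule odd_det3_zero_one[OF _ _ \<open>odd d\<close>]) (simp add: d_def c1_def c2_def c3_def)
    \<comment> \<open>Cramer's rule\<close>
    have "\<forall>j\<in>{1, 2, 3}. (S k 2 * S l 3 - S k 3 * S l 2) * S i j
        + (S l 2 * S i 3 - S l 3 * S i 2) * S k j + c1 * S l j = d * of_bool (j = 1)"
      by (simp add: d_def c1_def c2_def c3_def algebra_simps)
    moreover have "\<forall>j\<in>{1, 2, 3}. (S k 3 * S l 1 - S k 1 * S l 3) * S i j
        + (S l 3 * S i 1 - S l 1 * S i 3) * S k j + c2 * S l j = d * of_bool (j = 2)"
      by (simp add: d_def c1_def c2_def c3_def algebra_simps)
    moreover have "\<forall>j\<in>{1, 2, 3}. (S k 1 * S l 2 - S k 2 * S l 1) * S i j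
        + (S l 1 * S i 2 - S l 2 * S i 1) * S k j + c3 * S l j = d * of_bool (j = 3)"
      by (simp add: d_def c1_def c2_def c3_def algebra_simps)
    ultimately have "\<forall>h\<in>{1, 2, 3}. \<exists>p q s. \<forall>j\<in>{1, 2, 3}.
        p * S i j + q * S k j + s * S l j = d * of_bool (j = h)"
      by (intro ballI, elim insertE emptyE) (hypsubst, intro exI, assumption)+
    then show ?thesis
      by (intro rows_spanI_three_rows[OF assms(1) dd], unfold r)
        (rule bexI[OF bexI[OF bexI[OF _ l(1)] k(1)] i(1)], rule bspec)
  qed
qed

section \<open>The column lattice as a direct summand\<close>

text \<open>The coefficient vectors of the unit vectors are the rows of \<open>N\<close>, so the
  product of \<open>N\<close> and \<open>S\<close> is the identity. It is stated as applied to an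
  arbitrary vector \<open>c\<close>.\<close>

lemma rows_span_left_inverse:
  assumes "rows_span I r S"
  obtains N where "\<And>c k. k \<in> {1..r} \<Longrightarrow> (\<Sum>i\<in>I. N k i * (\<Sum>j=1..r. c j * S i j)) = c k"
proof -
  obtain N where N: "\<forall>k\<in>{1..r}. \<forall>j\<in>{1..r}. (\<Sum>i\<in>I. N k i * S i j) = of_bool (j = k)"
    using bchoice[OF assms[unfolded rows_span_def]] by blast
  have "(\<Sum>i\<in>I. N k i * (\<Sum>j=1..r. c j * S i j)) = c k" if k: "k \<in> {1..r}" for c k
  proof -
    have "(\<Sum>i\<in>I. N k i * (\<Sum>j=1..r. c j * S i j)) = (\<Sum>j=1..r. \<Sum>i\<in>I. c j * (N k i * S i j))"
      by (subst sum.swap) (simp add: sum_distrib_left mult_ac)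
    also have "\<dots> = (\<Sum>j=1..r. if j = k then c j else 0)"
      using N k by (intro sum.cong) (auto simp flip: sum_distrib_left)
    also have "\<dots> = c k" using k by simp
    finally show ?thesis .
  qed
  then show ?thesis using that by blast
qed

lemma group_Z_power: "group (Z_power m)"
  by (simp add: Z_power_def)

lemma Z_power_simps [simp]:
  "carrier (Z_power m) = {1..m} \<rightarrow>\<^sub>E UNIV"
  "\<one>\<^bsub>Z_power m\<^esub> = (\<lambda>i\<in>{1..m}. 0)"
  "x \<otimes>\<^bsub>Z_power m\<^esub> y = (\<lambda>i\<in>{1..m}. x i + y i)"
  by (simp_all add: Z_power_def)

text \<open>The combination map inside \<open>columns_basis_of\<close>, named so that it can be
  treated as a homomorphism.\<close>

definition matrix_map :: "nat \<Rightarrow> nat \<Rightarrow> (nat \<Rightarrow> nat \<Rightarrow> int) \<Rightarrow> (nat \<Rightarrow> int) \<Rightarrow> (nat \<Rightarrow> int)" where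
  "matrix_map m r S c = (\<lambda>i\<in>{1..m}. \<Sum>j=1..r. c j * S i j)"

lemma group_hom_matrix_map: "group_hom (Z_power r) (Z_power m) (matrix_map m r S)"
proof -
  have "matrix_map m r S \<in> hom (Z_power r) (Z_power m)"
  proof (rule homI)
    fix x y
    have "(\<Sum>j=1..r. (\<lambda>i\<in>{1..r}. x i + y i) j * S i j) = (\<Sum>j=1..r. x j * S i j + y j * S i j)" for i
      by (rule sum.cong) (auto simp: distrib_right)
    then show "matrix_map m r S (x \<otimes>\<^bsub>Z_power r\<^esub> y) =
        matrix_map m r S x \<otimes>\<^bsub>Z_power m\<^esub> matrix_map m r S y"
      by (auto simp: matrix_map_def sum.distrib)
  qed (simp add: matrix_map_def)
  then show ?thesis
    by (simp add: group_hom_def group_hom_axioms_def group_Z_power)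
qed

text \<open>An integral left inverse \<open>P\<close> of the matrix map splits it: the map is
  injective, and the kernel of \<open>P\<close> is a complement of its image.\<close>

lemma column_lattice_direct_summand:
  assumes "rows_span {1..m} r S"
  shows "columns_basis_of m r S (matrix_map m r S ` carrier (Z_power r))"
    and "direct_summand (Z_power m) (matrix_map m r S ` carrier (Z_power r))"
proof -
  obtain N where N: "\<And>c k. k \<in> {1..r} \<Longrightarrow>
      (\<Sum>i=1..m. N k i * (\<Sum>j=1..r. c j * S i j)) = c k"
    using rows_span_left_inverse[OF assms] by blast
  define P where "P = matrix_map r m (\<lambda>k i. N k i)"
  let ?f = "matrix_map m r S"
  have PS: "P (?f c) = c" if "c \<in> carrier (Z_power r)" for c
  proof
    fix k
    show "P (?f c) k = c k"
    proof (cases "k \<in> {1..r}")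
      case True
      have "P (?f c) k = (\<Sum>i=1..m. N k i * (\<Sum>j=1..r. c j * S i j))"
        using True by (auto simp: P_def matrix_map_def mult.commute intro!: sum.cong)
      then show ?thesis using N True by simp
    next
      case False
      \<comment> \<open>Off the index set both sides are the default value of extensional
        functions.\<close>
      moreover have "c k = undefined"
        using that False by (intro PiE_arb[of c "{1..r}"]) (simp only: Z_power_simps)
      ultimately show ?thesis by (auto simp: P_def matrix_map_def)
    qed
  qed
  interpret f: group_hom "Z_power r" "Z_power m" ?f by (rule group_hom_matrix_map)
  interpret P: group_hom "Z_power m" "Z_power r" P
    unfolding P_def by (rule group_hom_matrix_map)
  let ?L = "?f ` carrier (Z_power r)" and ?M = "kernel (Z_power m) (Z_power r) P"
  have "inj_on ?f (carrier (Z_power r))"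
    using PS by (metis inj_onI)
  then show "columns_basis_of m r S ?L"
    by (simp add: columns_basis_of_def bij_betw_def matrix_map_def[abs_def])
  have "?L \<inter> ?M \<subseteq> {\<one>\<^bsub>Z_power m\<^esub>}"
  proof
    fix x assume "x \<in> ?L \<inter> ?M"
    then obtain c where c: "c \<in> carrier (Z_power r)" "x = ?f c" "P x = \<one>\<^bsub>Z_power r\<^esub>"
      by (auto simp: kernel_def)
    then have "c = \<one>\<^bsub>Z_power r\<^esub>" using PS by simp
    then show "x \<in> {\<one>\<^bsub>Z_power m\<^esub>}" using c f.hom_one by simp
  qed
  moreover have "\<one>\<^bsub>Z_power m\<^esub> \<in> ?L \<inter> ?M"
    using f.img_is_subgroup P.subgroup_kernel subgroup.one_closed by blast
  moreover have "x \<in> ?L <#>\<^bsub>Z_power m\<^esub> ?M" if x: "x \<in> carrier (Z_power m)" for x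
  proof -
    \<comment> \<open>The splitting of \<open>x\<close>: \<open>?y\<close> is its projection to the
      lattice, and the remainder \<open>?z\<close> is killed by \<open>P\<close>.\<close>
    let ?y = "?f (P x)"
    let ?z = "inv\<^bsub>Z_power m\<^esub> ?y \<otimes>\<^bsub>Z_power m\<^esub> x"
    have Px: "P x \<in> carrier (Z_power r)" by (rule P.hom_closed[OF x])
    have y: "?y \<in> carrier (Z_power m)" by (rule f.hom_closed[OF Px])
    note inv_y = f.H.inv_closed[OF y]
    have z: "?z \<in> carrier (Z_power m)" by (rule f.H.m_closed[OF inv_y x])
    have "P ?z = inv\<^bsub>Z_power r\<^esub> (P ?y) \<otimes>\<^bsub>Z_power r\<^esub> P x"
      by (simp only: P.hom_mult[OF inv_y x] P.hom_inv[OF y])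
    also have "\<dots> = \<one>\<^bsub>Z_power r\<^esub>"
      by (simp only: PS[OF Px] f.G.l_inv[OF Px])
    finally have "?z \<in> ?M" using z unfolding kernel_def by blast
    moreover have "x = ?y \<otimes>\<^bsub>Z_power m\<^esub> ?z"
      by (simp only: f.H.m_assoc[OF y inv_y x, symmetric] f.H.r_inv[OF y] f.H.l_one[OF x])
    moreover have "?y \<in> ?L" using Px by (rule imageI)
    ultimately show ?thesis unfolding set_mult_def by blast
  qed
  moreover have "?L <#>\<^bsub>Z_power m\<^esub> ?M \<subseteq> carrier (Z_power m)"
    by (meson f.H.set_mult_closed f.img_is_subgroup P.subgroup_kernel subgroup.subset)
  ultimately show "direct_summand (Z_power m) ?L"
    unfolding direct_summand_def using f.img_is_subgroup P.subgroup_kernel by blast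
qed

section \<open>The torus of an integer matrix and its action\<close>

lemma circle_group_simps [simp]:
  "carrier circle_group = sphere 0 1" "\<one>\<^bsub>circle_group\<^esub> = 1" "x \<otimes>\<^bsub>circle_group\<^esub> y = x * y"
  by (simp_all add: circle_group_def)

lemma group_circle_group: "group circle_group"
proof (rule groupI)
  fix x assume "x \<in> carrier circle_group"
  then have "inverse x \<in> carrier circle_group" "inverse x \<otimes>\<^bsub>circle_group\<^esub> x = \<one>\<^bsub>circle_group\<^esub>"
    by (auto simp: norm_inverse intro!: left_inverse)
  then show "\<exists>y\<in>carrier circle_group. y \<otimes>\<^bsub>circle_group\<^esub> x = \<one>\<^bsub>circle_group\<^esub>" by blast
qed (auto simp: norm_mult)

lemma group_torus_group: "group (torus_group m)"
  by (simp add: torus_group_def group_circle_group)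

lemma torus_group_simps [simp]:
  "carrier (torus_group m) = {1..m} \<rightarrow>\<^sub>E sphere 0 1"
  "\<one>\<^bsub>torus_group m\<^esub> = (\<lambda>i\<in>{1..m}. 1)"
  "x \<otimes>\<^bsub>torus_group m\<^esub> y = (\<lambda>i\<in>{1..m}. x i * y i)"
  by (simp_all add: torus_group_def)

text \<open>The multiplicative counterpart of \<open>matrix_map\<close>: the homomorphism of tori
  given by the Laurent monomials whose exponents are the rows of \<open>S\<close>.\<close>

definition torus_map :: "nat \<Rightarrow> nat \<Rightarrow> (nat \<Rightarrow> nat \<Rightarrow> int) \<Rightarrow> (nat \<Rightarrow> complex) \<Rightarrow> (nat \<Rightarrow> complex)" where
  "torus_map m r S t = (\<lambda>i\<in>{1..m}. \<Prod>j=1..r. t j powi S i j)"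

lemma norm_torus_map:
  assumes "t \<in> carrier (torus_group r)"
  shows "norm (\<Prod>j=1..r. t j powi a j) = 1"
  using assms by (auto simp: norm_power_int PiE_iff simp flip: prod_norm)

lemma group_hom_torus_map: "group_hom (torus_group r) (torus_group m) (torus_map m r S)"
proof -
  have "torus_map m r S \<in> hom (torus_group r) (torus_group m)"
  proof (rule homI)
    fix x y :: "nat \<Rightarrow> complex"
    have "(\<Prod>j=1..r. (\<lambda>i\<in>{1..r}. x i * y i) j powi S i j) =
        (\<Prod>j=1..r. x j powi S i j * y j powi S i j)" for i
      by (rule prod.cong) (auto simp: power_int_mult_distrib)
    then show "torus_map m r S (x \<otimes>\<^bsub>torus_group r\<^esub> y) =
        torus_map m r S x \<otimes>\<^bsub>torus_group m\<^esub> torus_map m r S y"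
      by (auto simp: torus_map_def prod.distrib)
  qed (use norm_torus_map in \<open>auto simp: torus_map_def\<close>)
  then show ?thesis
    by (simp add: group_hom_def group_hom_axioms_def group_torus_group)
qed

lemma power_int_prod:
  fixes f :: "'a \<Rightarrow> 'b :: field"
  shows "(\<Prod>i\<in>I. f i) powi n = (\<Prod>i\<in>I. f i powi n)"
  by (induction I rule: infinite_finite_induct) (simp_all add: power_int_mult_distrib)

lemma power_int_sum:
  fixes x :: "'b :: field"
  assumes "x \<noteq> 0"
  shows "x powi (\<Sum>i\<in>I. a i) = (\<Prod>i\<in>I. x powi a i)"
  using assms by (induction I rule: infinite_finite_induct) (simp_all add: power_int_add)

text \<open>The monomials of the rows in \<open>I\<close>, raised to the powers \<open>a i\<close>
  and multiplied, give the monomial whose exponent is the k-th unit vector, that is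
  \<open>t k\<close>. With all rows this gives injectivity, with the rows off a simplex
  freeness.\<close>

lemma torus_map_trivial_on_spanning_rows:
  assumes span: "rows_span I r S" and I: "I \<subseteq> {1..m}"
    and t: "t \<in> carrier (torus_group r)"
    and triv: "\<And>i. i \<in> I \<Longrightarrow> torus_map m r S t i = 1"
  shows "t = \<one>\<^bsub>torus_group r\<^esub>"
proof
  fix k
  \<comment> \<open>Exponents can be added only over a nonzero base.\<close>
  have t0: "t j \<noteq> 0" if "j \<in> {1..r}" for j
    using t that PiE_mem[of t "{1..r}" "\<lambda>_. sphere 0 1" j] by auto
  show "t k = \<one>\<^bsub>torus_group r\<^esub> k"
  proof (cases "k \<in> {1..r}")
    case True
    then obtain a where a: "\<forall>j\<in>{1..r}. (\<Sum>i\<in>I. a i * S i j) = of_bool (j = k)"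
      using span unfolding rows_span_def by blast
    have "1 = (\<Prod>i\<in>I. torus_map m r S t i powi a i)"
      using triv by simp
    also have "\<dots> = (\<Prod>i\<in>I. \<Prod>j=1..r. t j powi (a i * S i j))"
      using I by (intro prod.cong)
        (auto simp: torus_map_def power_int_prod power_int_mult mult.commute[of "a _"])
    also have "\<dots> = (\<Prod>j=1..r. t j powi (\<Sum>i\<in>I. a i * S i j))"
      using t0 by (subst prod.swap) (auto intro!: prod.cong simp: power_int_sum)
    also have "\<dots> = (\<Prod>j=1..r. if j = k then t j else 1)"
      using a by (intro prod.cong) auto
    also have "\<dots> = t k" using True by simp
    finally show ?thesis using True by simp
  next
    case False
    moreover have "t k = undefined"
      using t False by (intro PiE_arb[of t "{1..r}"]) (simp only: torus_group_simps)
    ultimately show ?thesis by auto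
  qed
qed

text \<open>The real parametrization of \<open>matrix_torus\<close> factors through the covering
  \<open>e\<close> of the r-torus by real vectors, and \<open>e\<close> is onto.\<close>

lemma image_torus_map: "torus_map m r S ` carrier (torus_group r) = matrix_torus m r S"
proof -
  define e where "e \<phi> = (\<lambda>j\<in>{1..r}. cis (2 * pi * \<phi> j))" for \<phi> :: "nat \<Rightarrow> real"
  have e: "torus_map m r S (e \<phi>) =
      (\<lambda>i\<in>{1..m}. exp (2 * of_real pi * \<i> * of_real (\<Sum>j=1..r. of_int (S i j) * \<phi> j)))" for \<phi>
  proof -
    have "(\<Prod>j=1..r. e \<phi> j powi S i j) =
        exp (2 * of_real pi * \<i> * of_real (\<Sum>j=1..r. of_int (S i j) * \<phi> j))" for i
    proof -
      have "(\<Prod>j=1..r. e \<phi> j powi S i j) =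
          (\<Prod>j=1..r. exp (\<i> * of_real (2 * pi * (of_int (S i j) * \<phi> j))))"
      proof (rule prod.cong)
        fix j assume "j \<in> {1..r}"
        then have "e \<phi> j powi S i j = cis (of_int (S i j) * (2 * pi * \<phi> j))"
          by (simp add: e_def cis_power_int)
        also have "of_int (S i j) * (2 * pi * \<phi> j) = 2 * pi * (of_int (S i j) * \<phi> j)"
          by (rule mult.left_commute)
        finally show "e \<phi> j powi S i j = exp (\<i> * of_real (2 * pi * (of_int (S i j) * \<phi> j)))"
          by (simp only: cis_conv_exp)
      qed simp
      also have "\<dots> = exp (\<Sum>j=1..r. \<i> * of_real (2 * pi * (of_int (S i j) * \<phi> j)))"
        by (simp add: exp_sum)
      finally show ?thesis by (simp add: sum_distrib_left mult_ac)
    qed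
    then show ?thesis by (simp add: torus_map_def)
  qed
  have "range e = carrier (torus_group r)"
  proof
    show "carrier (torus_group r) \<subseteq> range e"
    proof
      fix t assume t: "t \<in> carrier (torus_group r)"
      have "t = e (\<lambda>j. Arg (t j) / (2 * pi))"
      proof
        fix j
        show "t j = e (\<lambda>j. Arg (t j) / (2 * pi)) j"
        proof (cases "j \<in> {1..r}")
          case True
          then have "norm (t j) = 1" using t by (auto simp: PiE_iff)
          then have "cis (Arg (t j)) = t j"
            using rcis_cmod_Arg[of "t j"] by (simp add: rcis_def)
          then show ?thesis using True by (simp add: e_def)
        next
          case False
          moreover have "t j = undefined"
            using t False by (intro PiE_arb[of t "{1..r}"]) (simp only: torus_group_simps)
          ultimately show ?thesis by (auto simp: e_def)
        qed
      qed
      then show "t \<in> range e" by blast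
    qed
  qed (auto simp: e_def)
  then have "torus_map m r S ` carrier (torus_group r) = range (\<lambda>\<phi>. torus_map m r S (e \<phi>))"
    using image_image[of "torus_map m r S" e UNIV] by (simp only:)
  also have "\<dots> = matrix_torus m r S"
    unfolding e matrix_torus_def by (simp only: full_SetCompr_eq simp_thms)
  finally show ?thesis .
qed

lemma topspace_torus_topology [simp]: "topspace (torus_topology m) = carrier (torus_group m)"
  by (simp add: torus_topology_def)

lemma continuous_map_torus_map:
  "continuous_map (torus_topology r) (torus_topology m) (torus_map m r S)"
  unfolding torus_topology_def[of m]
proof (rule continuous_map_coordinatewise_then_product)
  fix i assume i: "i \<in> {1..m}"
  have pow: "continuous_map (torus_topology r) euclidean (\<lambda>t. t j powi n)" if "j \<in> {1..r}" for j n
  proof -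
    have "continuous_map (torus_topology r) (top_of_set (sphere 0 1)) (\<lambda>t. t j)"
      unfolding torus_topology_def
      by (rule continuous_map_product_projection[OF that])
    moreover have "continuous_map (top_of_set (sphere 0 1)) euclidean (\<lambda>z::complex. z powi n)"
      by (auto intro!: continuous_intros)
    ultimately show ?thesis
      using continuous_map_compose[unfolded comp_def] by blast
  qed
  have "continuous_map (torus_topology r) euclidean (\<lambda>t. \<Prod>j=1..r. t j powi S i j)"
    using pow by (auto simp: continuous_map_atin intro!: tendsto_prod)
  then show "continuous_map (torus_topology r) (top_of_set (sphere 0 1)) (\<lambda>t. torus_map m r S t i)"
    using i norm_torus_map by (auto simp: continuous_map_in_subtopology torus_map_def)
qed (auto simp: torus_map_def)

text \<open>The monomial map is the required isomorphism. Its inverse is continuous because a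
  continuous bijection from a compact space to a Hausdorff space is a homeomorphism.\<close>

lemma subtorus_matrix_torus:
  assumes "rows_span {1..m} r S"
  shows "subtorus m r (matrix_torus m r S)"
proof -
  interpret group_hom "torus_group r" "torus_group m" "torus_map m r S"
    by (rule group_hom_torus_map)
  let ?H = "matrix_torus m r S" and ?f = "torus_map m r S"
  have inj: "inj_on ?f (carrier (torus_group r))"
  proof (rule inj_on_one_iff[THEN iffD2], intro allI impI)
    fix t assume "t \<in> carrier (torus_group r)" "?f t = \<one>\<^bsub>torus_group m\<^esub>"
    then show "t = \<one>\<^bsub>torus_group r\<^esub>"
      by (intro torus_map_trivial_on_spanning_rows[OF assms]) auto
  qed
  have H: "subgroup ?H (torus_group m)"
    using img_is_subgroup by (simp only: image_torus_map)
  have "?f \<in> iso (torus_group r) ((torus_group m)\<lparr>carrier := ?H\<rparr>)"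
    unfolding iso_def hom_def bij_betw_def
    using inj image_torus_map[of m r S] homh by (auto simp: hom_def simp del: torus_group_simps)
  moreover have "homeomorphic_map (torus_topology r) (subtopology (torus_topology m) ?H) ?f"
  proof (rule continuous_imp_homeomorphic_map)
    show "continuous_map (torus_topology r) (subtopology (torus_topology m) ?H) ?f"
      using continuous_map_torus_map image_torus_map[of m r S]
      by (auto simp: continuous_map_in_subtopology simp del: torus_group_simps)
    show "compact_space (torus_topology r)"
      by (simp add: torus_topology_def compact_space_product_topology compact_space_subtopology)
    show "Hausdorff_space (subtopology (torus_topology m) ?H)"
      by (simp add: torus_topology_def Hausdorff_space_subtopology Hausdorff_space_product_topology)
    show "?f ` topspace (torus_topology r) = topspace (subtopology (torus_topology m) ?H)"
      using subgroup.subset[OF H] image_torus_map[of m r S]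
      by (auto simp del: torus_group_simps)
  qed (use inj in simp)
  ultimately show ?thesis unfolding subtorus_def using H by blast
qed

text \<open>A point in the piece of \<open>\<sigma>\<close> has nonzero coordinates off
  \<open>\<sigma>\<close>, so a stabilizing element is 1 there. The rows off \<open>\<sigma>\<close>
  span, hence its parameter is trivial.\<close>

lemma acts_freely_matrix_torus:
  assumes span: "\<And>\<sigma>. \<sigma> \<in> K \<Longrightarrow> rows_span ({1..m} - \<sigma>) r S"
  shows "acts_freely ((torus_group m)\<lparr>carrier := matrix_torus m r S\<rparr>) (torus_action m)
           (moment_angle_complex m K)"
  unfolding acts_freely_def
proof
  interpret group_hom "torus_group r" "torus_group m" "torus_map m r S"
    by (rule group_hom_torus_map)
  fix x assume "x \<in> moment_angle_complex m K"
  then obtain \<sigma> where \<sigma>: "\<sigma> \<in> K" and x: "x \<in> {1..m} \<rightarrow>\<^sub>E cball 0 1"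
    and xs: "\<forall>i\<in>{1..m}. i \<notin> \<sigma> \<longrightarrow> x i \<in> sphere 0 1"
    unfolding moment_angle_complex_def polyhedral_product_def UN_iff mem_Collect_eq by (elim bexE conjE)
  have "t = \<one>\<^bsub>torus_group m\<^esub>" if t: "t \<in> matrix_torus m r S" and fixed: "torus_action m t x = x" for t
  proof -
    obtain u where u: "u \<in> carrier (torus_group r)" "t = torus_map m r S u"
      using t image_torus_map[of m r S] by blast
    have "t i = 1" if i: "i \<in> {1..m} - \<sigma>" for i
    proof -
      have "t i * x i = x i"
        using fun_cong[OF fixed, of i] i by (simp add: torus_action_def)
      moreover have "x i \<noteq> 0" using xs i by fastforce
      ultimately show ?thesis by simp
    qed
    then have "u = \<one>\<^bsub>torus_group r\<^esub>"
      using torus_map_trivial_on_spanning_rows[OF span[OF \<sigma>] Diff_subset u(1)] u(2) by blast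
    then show ?thesis using u(2) by (simp only: hom_one)
  qed
  moreover have "\<one>\<^bsub>torus_group m\<^esub> \<in> matrix_torus m r S"
    using subgroup.one_closed[OF img_is_subgroup] by (simp only: image_torus_map)
  moreover have "torus_action m \<one>\<^bsub>torus_group m\<^esub> x = x"
  proof
    fix i
    show "torus_action m \<one>\<^bsub>torus_group m\<^esub> x i = x i"
      using PiE_arb[OF x, of i] by (auto simp: torus_action_def)
  qed
  ultimately have "{t \<in> matrix_torus m r S. torus_action m t x = x} = {\<one>\<^bsub>torus_group m\<^esub>}"
    by blast
  then show "stabilizer ((torus_group m)\<lparr>carrier := matrix_torus m r S\<rparr>) (torus_action m) x =
      {\<one>\<^bsub>(torus_group m)\<lparr>carrier := matrix_torus m r S\<rparr>\<^esub>}"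
    by (simp add: stabilizer_def)
qed

section \<open>Subgroups of the sign group, their bases and free actions\<close>

lemma Z2_power_simps [simp]:
  "carrier (Z2_power m) = {1..m} \<rightarrow>\<^sub>E {0, 1}"
  "\<one>\<^bsub>Z2_power m\<^esub> = (\<lambda>i\<in>{1..m}. 0)"
  "x \<otimes>\<^bsub>Z2_power m\<^esub> y = (\<lambda>i\<in>{1..m}. (x i + y i) mod 2)"
proof -
  have "{0..<int 2} = {0, 1}" by auto
  then show "carrier (Z2_power m) = {1..m} \<rightarrow>\<^sub>E {0, 1}"
    by (simp add: Z2_power_def carrier_integer_mod_group)
qed (simp_all add: Z2_power_def)

lemma group_Z2_power: "group (Z2_power m)"
  by (simp add: Z2_power_def)

text \<open>The columns are the images of the unit vectors under an isomorphism onto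
  \<open>G\<close>. A mod 2 combination of columns is a sum over a subset, so freeness of the basis
  becomes a bijection from \<open>Pow {1..r}\<close>.\<close>

lemma Z2_subgroup_of_rank_basis:
  assumes "Z2_subgroup_of_rank m r G"
  obtains S where "\<And>i j. i \<in> {1..m} \<Longrightarrow> j \<in> {1..r} \<Longrightarrow> S i j \<in> {0, 1}"
    and "bij_betw (\<lambda>A. \<lambda>i\<in>{1..m}. (\<Sum>j\<in>A. S i j) mod 2) (Pow {1..r}) G"
proof -
  have G: "subgroup G (Z2_power m)" and "(Z2_power m)\<lparr>carrier := G\<rparr> \<cong> Z2_power r"
    using assms by (auto simp: Z2_subgroup_of_rank_def)
  then have "Z2_power r \<cong> (Z2_power m)\<lparr>carrier := G\<rparr>"
    using group.iso_sym group.subgroup_imp_group group_Z2_power by blast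
  then obtain f where f: "f \<in> hom (Z2_power r) ((Z2_power m)\<lparr>carrier := G\<rparr>)"
    and bij: "bij_betw f (carrier (Z2_power r)) G"
    by (auto simp: is_iso_def iso_def)
  define chi :: "nat set \<Rightarrow> nat \<Rightarrow> int" where "chi A = (\<lambda>j\<in>{1..r}. of_bool (j \<in> A))" for A
  \<comment> \<open>Residues are the integers 0 and 1, so this matrix is already its own integral
    lift.\<close>
  define S where "S i j = f (chi {j}) i" for i j
  have chi: "chi A \<in> carrier (Z2_power r)" for A
    by (auto simp: chi_def)
  have fchi: "f (chi A) \<in> {1..m} \<rightarrow>\<^sub>E {0, 1}" for A
    using bij_betwE[OF bij] chi[of A] subgroup.subset[OF G] by (auto simp del: PiE_iff)
  have f_mult: "f (x \<otimes>\<^bsub>Z2_power r\<^esub> y) = f x \<otimes>\<^bsub>Z2_power m\<^esub> f y"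
    if "x \<in> carrier (Z2_power r)" "y \<in> carrier (Z2_power r)" for x y
    using hom_mult[OF f that] by simp
  have f_chi: "f (chi A) = (\<lambda>i\<in>{1..m}. (\<Sum>j\<in>A. S i j) mod 2)" if "A \<subseteq> {1..r}" for A
    using finite_subset[OF that finite_atLeastAtMost] that
  proof (induction A rule: finite_induct)
    case empty
    have "chi {} = \<one>\<^bsub>Z2_power r\<^esub>" by (auto simp: chi_def)
    moreover have "f \<one>\<^bsub>Z2_power r\<^esub> = \<one>\<^bsub>Z2_power m\<^esub>"
      using hom_one[OF f group_Z2_power] group.subgroup_imp_group[OF group_Z2_power G] by simp
    ultimately show ?case by (simp only: Z2_power_simps sum.empty mod_0)
  next
    case (insert j A)
    have "chi (insert j A) = chi {j} \<otimes>\<^bsub>Z2_power r\<^esub> chi A"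
      using insert by (auto simp: chi_def)
    then have "f (chi (insert j A)) = f (chi {j}) \<otimes>\<^bsub>Z2_power m\<^esub> f (chi A)"
      using f_mult[OF chi chi] by simp
    then show ?case
      using insert by (auto simp: S_def mod_add_right_eq)
  qed
  have "bij_betw chi (Pow {1..r}) (carrier (Z2_power r))"
  \<comment> \<open>The inverse of \<open>chi\<close> takes a 0/1 vector to its support.\<close>
  proof (rule bij_betwI[where g = "\<lambda>x. {j\<in>{1..r}. x j = 1}"])
    fix x assume "x \<in> carrier (Z2_power r)"
    then have x: "x \<in> {1..r} \<rightarrow>\<^sub>E {0, 1}" by simp
    show "chi {j \<in> {1..r}. x j = 1} = x"
    proof
      fix j
      show "chi {j \<in> {1..r}. x j = 1} j = x j"
        using PiE_mem[OF x, of j] PiE_arb[OF x, of j] by (cases "j \<in> {1..r}") (auto simp: chi_def)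
    qed
  qed (use chi in \<open>auto simp: chi_def split: if_splits\<close>)
  from bij_betw_trans[OF this bij]
  have "bij_betw (\<lambda>A. \<lambda>i\<in>{1..m}. (\<Sum>j\<in>A. S i j) mod 2) (Pow {1..r}) G"
    by (rule bij_betw_cong[THEN iffD1, rotated]) (simp add: f_chi)
  moreover have "S i j \<in> {0, 1}" if "i \<in> {1..m}" for i j
    unfolding S_def by (rule PiE_mem[OF fchi that])
  ultimately show ?thesis using that by blast
qed

text \<open>Singletons give the generators, which lie in \<open>G\<close>; conversely each subset
  sum is built up from columns by induction on the subset.\<close>

lemma mod2_column_span_eq:
  assumes G: "subgroup G (Z2_power m)"
    and bij: "bij_betw (\<lambda>A. \<lambda>i\<in>{1..m}. (\<Sum>j\<in>A. S i j) mod 2) (Pow {1..r}) G"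
  shows "mod2_column_span m r S = G"
proof -
  let ?g = "\<lambda>A. \<lambda>i\<in>{1..m}. (\<Sum>j\<in>A. S i j) mod 2"
  let ?B = "(\<lambda>j. \<lambda>i\<in>{1..m}. S i j mod 2) ` {1..r}"
  have "?g {j} \<in> G" if "j \<in> {1..r}" for j
    using bij_betwE[OF bij] that by blast
  then have "?B \<subseteq> G" by auto
  then have "generate (Z2_power m) ?B \<subseteq> G"
    by (rule group.generate_subgroup_incl[OF group_Z2_power _ G])
  moreover have "?g A \<in> generate (Z2_power m) ?B" if "A \<subseteq> {1..r}" for A
    using finite_subset[OF that finite_atLeastAtMost] that
  proof (induction A rule: finite_induct)
    case empty
    show ?case using generate.one[of "Z2_power m" ?B] by (simp only: Z2_power_simps sum.empty mod_0)
  next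
    case (insert j A)
    have "?g (insert j A) = (\<lambda>i\<in>{1..m}. S i j mod 2) \<otimes>\<^bsub>Z2_power m\<^esub> ?g A"
      using insert by (auto simp: mod_add_eq)
    also have "\<dots> \<in> generate (Z2_power m) ?B"
      by (rule generate.eng[OF generate.incl]) (use insert in blast)+
    finally show ?case .
  qed
  then have "G \<subseteq> generate (Z2_power m) ?B"
    using bij_betw_imp_surj_on[OF bij] by blast
  ultimately show ?thesis
    unfolding mod2_column_span_def by blast
qed

text \<open>An element supported in \<open>\<sigma>\<close> fixes the point with coordinates 0 on
  \<open>\<sigma>\<close> and 1 elsewhere, so under a free action it is trivial.\<close>

lemma free_sign_action_odd_row:
  assumes free: "acts_freely ((Z2_power m)\<lparr>carrier := G\<rparr>) (sign_action m) (real_moment_angle_complex m K)"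
    and \<sigma>: "\<sigma> \<in> K" and g: "g \<in> G" "G \<subseteq> carrier (Z2_power m)" "g \<noteq> \<one>\<^bsub>Z2_power m\<^esub>"
  shows "\<exists>i\<in>{1..m} - \<sigma>. g i = 1"
proof (rule ccontr)
  assume no: "\<not> ?thesis"
  \<comment> \<open>Sign changes fix the centre 0 of the interval, which is allowed exactly at the
    indices in \<open>\<sigma>\<close>.\<close>
  define x :: "nat \<Rightarrow> real" where "x = (\<lambda>i\<in>{1..m}. of_bool (i \<notin> \<sigma>))"
  have "x \<in> real_moment_angle_complex m K"
    using \<sigma> by (auto simp: real_moment_angle_complex_def polyhedral_product_def x_def)
  moreover have "sign_action m g x = x"
  proof
    fix i
    have "g i = 0" if "i \<in> {1..m}" "i \<notin> \<sigma>"
      using no g that PiE_mem[of g "{1..m}" "\<lambda>_. {0, 1}" i] by auto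
    then show "sign_action m g x i = x i"
      by (cases "i \<in> {1..m} \<and> i \<notin> \<sigma>") (auto simp: sign_action_def x_def)
  qed
  ultimately show False
    using free g(1,3) by (auto simp: acts_freely_def stabilizer_def simp del: Z2_power_simps)
qed

theorem theorem2p2:
  fixes m n r :: nat and K :: "nat set set" and G :: "(nat \<Rightarrow> int) set"
  assumes "simplicial_complex_on m K"
    and "complex_dim K = int n - 1"
    and "r \<le> 3"
    and "Z2_subgroup_of_rank m r G"
    and "acts_freely ((Z2_power m)\<lparr>carrier := G\<rparr>) (sign_action m) (real_moment_angle_complex m K)"
  shows "\<exists>H. subtorus m r H \<and>
             acts_freely ((torus_group m)\<lparr>carrier := H\<rparr>) (torus_action m) (moment_angle_complex m K) \<and>
             induced_by_subtorus m r G H"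
proof -
  obtain S where S01: "\<And>i j. i \<in> {1..m} \<Longrightarrow> j \<in> {1..r} \<Longrightarrow> S i j \<in> {0, 1}"
    and bij: "bij_betw (\<lambda>A. \<lambda>i\<in>{1..m}. (\<Sum>j\<in>A. S i j) mod 2) (Pow {1..r}) G" (is "bij_betw ?g _ _")
    using Z2_subgroup_of_rank_basis[OF assms(4)] by blast
  have G: "subgroup G (Z2_power m)"
    using assms(4) by (simp add: Z2_subgroup_of_rank_def)
  have span: "rows_span ({1..m} - \<sigma>) r S" if \<sigma>: "\<sigma> \<in> K" for \<sigma>
  proof (rule rows_span_zero_one[OF _ assms(3)])
    fix A assume A: "A \<subseteq> {1..r}" "A \<noteq> {}"
    \<comment> \<open>Injectivity of the subset sums is linear independence of the columns: a
      nonempty sum is a nontrivial element of \<open>G\<close>, to which freeness applies.\<close>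
    then have "?g A \<noteq> ?g {}"
      using bij_betw_imp_inj_on[OF bij] by (metis Pow_iff empty_subsetI inj_on_def)
    moreover have "?g {} = \<one>\<^bsub>Z2_power m\<^esub>" by simp
    moreover have "?g A \<in> G" using bij_betwE[OF bij] A by blast
    ultimately obtain i where "i \<in> {1..m} - \<sigma>" "?g A i = 1"
      using free_sign_action_odd_row[OF assms(5) \<sigma>] subgroup.subset[OF G] by metis
    then show "\<exists>i\<in>{1..m} - \<sigma>. odd (\<Sum>j\<in>A. S i j)"
      by (auto simp: odd_iff_mod_2_eq_one)
  qed (use S01 in auto)
  have "{} \<in> K" using assms(1) by (simp add: simplicial_complex_on_def)
  from span[OF this] have full: "rows_span {1..m} r S" by simp
  have "induced_by_subtorus m r G (matrix_torus m r S)"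
    unfolding induced_by_subtorus_def
    using column_lattice_direct_summand[OF full] mod2_column_span_eq[OF G bij] by blast
  then show ?thesis
    using subtorus_matrix_torus[OF full] acts_freely_matrix_torus[OF span] by blast
qed

end
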